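(* Let $k=3$ and $r_1\ge r_2\ge r_3\ge 1$. If $(r_1-1)\ge (r_2-1)+(r_3-1)$, then the arithmetic mean component competitive ratio for the 3-objective time series search problem is $$z_f^3=\frac16\left[\sqrt{4r_1+\{(r_2-1)+(r_3-1)\}^2}+(r_2+1)+(r_3+1)\right].$$
   Context: For an integer $k\ge 2$ and reals $0<m_i\le M_i$ ($1\le i\le k$), let $r_i=M_i/m_i$ be the fluctuation ratio of the price interval $[m_i,M_i]$ of the $i$th objective. It is assumed throughout that $r_1\ge\cdots\ge r_k\ge 1$. The arithmetic mean component competitive ratio of the $k$-objective time series search problem is the quantity $$z_f^k=\sup_{(x_1,\ldots,x_k)\in\mathcal{S}_f^k}\frac1k\left(\frac{M_1}{x_1}+\cdots+\frac{M_k}{x_k}\right),$$ where $$\mathcal{S}_f^k=\left\{(x_1,\ldots,x_k)\in[m_1,M_1]\times\cdots\times[m_k,M_k] : \frac1k\sum_{i=1}^k\frac{x_i}{m_i}=\frac1k\sum_{i=1}^k\frac{M_i}{x_i}\right\}.$$ *)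

theory Defs
  imports Complex_Main "HOL-Library.FuncSet"
begin

text \<open>
  The objectives are indexed by \<open>{1..k}\<close>; a \<open>k\<close>-tuple is a function on \<open>nat\<close> that
  is \<^const>\<open>undefined\<close> outside \<open>{1..k}\<close>.
\<close>

definition arith_mean :: "nat \<Rightarrow> (nat \<Rightarrow> real) \<Rightarrow> real" where
  "arith_mean k c = (\<Sum>i=1..k. c i) / real k"

definition S_f :: "nat \<Rightarrow> (nat \<Rightarrow> real) \<Rightarrow> (nat \<Rightarrow> real) \<Rightarrow> (nat \<Rightarrow> real) set" where
  "S_f k m M = {x \<in> (\<Pi>\<^sub>E i\<in>{1..k}. {m i..M i}).
     arith_mean k (\<lambda>i. x i / m i) = arith_mean k (\<lambda>i. M i / x i)}"

text \<open>
  For \<open>k \<ge> 1\<close> and \<open>0 < m i \<le> M i\<close> the supremum below is over a nonempty set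
  (it contains the value at \<open>x i = sqrt (m i * M i)\<close>) that is bounded above by
  \<open>arith_mean k (\<lambda>i. M i / m i)\<close>, so the real-valued supremum is the usual one.
\<close>

definition z_f :: "nat \<Rightarrow> (nat \<Rightarrow> real) \<Rightarrow> (nat \<Rightarrow> real) \<Rightarrow> real" where
  "z_f k m M = (SUP x\<in>S_f k m M. arith_mean k (\<lambda>i. M i / x i))"

end

theory Submission
  imports Defs
begin

text \<open>
  Put \<open>y\<^sub>i = x\<^sub>i / m\<^sub>i \<in> [1, r\<^sub>i]\<close> and \<open>d\<^sub>i = y\<^sub>i - r\<^sub>i / y\<^sub>i\<close>. The constraint says \<open>\<Sum> d\<^sub>i = 0\<close>, and then
  twice the common value of the two sums is \<open>\<Sum> (y\<^sub>i + r\<^sub>i / y\<^sub>i)\<close>, where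
  \<open>y\<^sub>i + r\<^sub>i / y\<^sub>i = sqrt (4 * r\<^sub>i + d\<^sub>i\<^sup>2)\<close>. Since \<open>\<bar>d\<^sub>i\<bar> \<le> r\<^sub>i - 1\<close>, the terms for \<open>i = 2, 3\<close> are at most
  \<open>r\<^sub>i + 1\<close>, and \<open>\<bar>d\<^sub>1\<bar> = \<bar>d\<^sub>2 + d\<^sub>3\<bar> \<le> (r\<^sub>2 - 1) + (r\<^sub>3 - 1)\<close> bounds the first one. Equality holds for
  \<open>y\<^sub>2 = r\<^sub>2\<close>, \<open>y\<^sub>3 = r\<^sub>3\<close>; the hypothesis on \<open>r\<^sub>1\<close> makes the corresponding \<open>y\<^sub>1\<close> admissible.
\<close>

lemma add_divide_le_add_one:
  fixes y r :: real
  assumes "1 \<le> y" "y \<le> r"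
  shows "y + r / y \<le> r + 1"
proof -
  have "0 \<le> (y - 1) * (r - y)" using assms by simp
  then show ?thesis using assms by (simp add: field_simps)
qed

lemma abs_diff_divide_le_diff_one:
  fixes y r :: real
  assumes "1 \<le> y" "y \<le> r"
  shows "\<bar>y - r / y\<bar> \<le> r - 1"
proof -
  have "1 \<le> r / y" "r / y \<le> r" using assms by (simp_all add: field_simps)
  then show ?thesis using assms by linarith
qed

lemma add_divide_le_sqrt:
  fixes y r a :: real
  assumes "0 < y" "\<bar>y - r / y\<bar> \<le> a"
  shows "y + r / y \<le> sqrt (4 * r + a\<^sup>2)"
proof (rule real_le_rsqrt)
  have "(y + r / y)\<^sup>2 = 4 * r + (y - r / y)\<^sup>2"
    using assms(1) by (simp add: power2_sum power2_diff)
  moreover have "(y - r / y)\<^sup>2 \<le> a\<^sup>2"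
    using assms(2) by (metis abs_ge_zero power2_abs power_mono)
  ultimately show "(y + r / y)\<^sup>2 \<le> 4 * r + a\<^sup>2" by simp
qed

text \<open>The two formulas amount to \<open>y - r / y = - a\<close>: \<open>y\<close> is the
  positive root of \<open>y * y + a * y = r\<close>.\<close>

lemma ex_diff_divide_eq:
  fixes r a :: real
  assumes "0 \<le> a" "a \<le> r - 1"
  obtains y where "1 \<le> y" "y \<le> r" "y = (sqrt (4 * r + a\<^sup>2) - a) / 2"
    "r / y = (sqrt (4 * r + a\<^sup>2) + a) / 2"
proof -
  define s where "s = sqrt (4 * r + a\<^sup>2)"
  define y where "y = (s - a) / 2"
  \<comment> \<open>Squared, this reads \<open>4 * a + 4 \<le> 4 * r\<close>, which is the
    assumption \<open>a \<le> r - 1\<close>.\<close>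
  have "a + 2 \<le> s"
    unfolding s_def using assms by (intro real_le_rsqrt) (simp add: power2_sum)
  then have y1: "1 \<le> y" by (simp add: y_def)
  have "s\<^sup>2 = 4 * r + a\<^sup>2" using assms by (simp add: s_def)
  then have "r = y * ((s + a) / 2)"
    by (simp add: y_def algebra_simps power2_eq_square)
  then have ry: "r / y = (s + a) / 2" using y1 by (simp add: field_simps)
  have "1 \<le> r / y" using ry \<open>a + 2 \<le> s\<close> assms(1) by simp
  then have "y \<le> r" using y1 by (simp add: field_simps)
  with y1 ry that show thesis unfolding s_def y_def by blast
qed

theorem theorem5p1:
  fixes m M r :: "nat \<Rightarrow> real"
  assumes "\<And>i. i \<in> {1..3} \<Longrightarrow> 0 < m i \<and> m i \<le> M i"
    and "\<And>i. i \<in> {1..3} \<Longrightarrow> r i = M i / m i"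
    and "r 1 \<ge> r 2" and "r 2 \<ge> r 3" and "r 3 \<ge> 1"
    and "r 1 - 1 \<ge> (r 2 - 1) + (r 3 - 1)"
  shows "z_f 3 m M =
    1 / 6 * (sqrt (4 * r 1 + ((r 2 - 1) + (r 3 - 1))\<^sup>2) + (r 2 + 1) + (r 3 + 1))"
proof -
  note One_nat_def [simp del]
  define a where "a = (r 2 - 1) + (r 3 - 1)"
  have I: "{1..3} = {1, 2, 3::nat}" by auto
  have mean: "arith_mean 3 c = (c 1 + c 2 + c 3) / 3" for c
    unfolding arith_mean_def I by simp
  have pos: "0 < m i" "m i \<le> M i" and M: "M i = r i * m i" if "i \<in> {1..3}" for i
    using assms(1,2)[OF that] by simp_all
  have upper: "arith_mean 3 (\<lambda>i. M i / x i) \<le>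
      1 / 6 * (sqrt (4 * r 1 + a\<^sup>2) + (r 2 + 1) + (r 3 + 1))"
    if x: "x \<in> S_f 3 m M" for x
  proof -
    define y where "y i = x i / m i" for i
    define w where "w i = M i / x i" for i
    have y: "1 \<le> y i" "y i \<le> r i" and w: "w i = r i / y i" if "i \<in> {1..3}" for i
    proof -
      have "m i \<le> x i" "x i \<le> M i" using x that by (auto simp: S_f_def PiE_iff)
      then show "1 \<le> y i" "y i \<le> r i" "w i = r i / y i"
        using pos(1)[OF that] M[OF that] by (simp_all add: y_def w_def field_simps)
    qed
    have eq: "y 1 + y 2 + y 3 = w 1 + w 2 + w 3"
      using x unfolding S_f_def mem_Collect_eq mean y_def[symmetric] w_def[symmetric] by simp
    have "\<bar>y 2 - w 2\<bar> \<le> r 2 - 1" "\<bar>y 3 - w 3\<bar> \<le> r 3 - 1"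
      using y by (simp_all add: w abs_diff_divide_le_diff_one)
    then have "\<bar>y 1 - w 1\<bar> \<le> a" using eq unfolding a_def by linarith
    moreover have "0 < y 1" using y(1)[of 1] by simp
    ultimately have "y 1 + w 1 \<le> sqrt (4 * r 1 + a\<^sup>2)"
      using add_divide_le_sqrt[of "y 1" "r 1" a] by (simp add: w)
    moreover have "y 2 + w 2 \<le> r 2 + 1" "y 3 + w 3 \<le> r 3 + 1"
      using y by (simp_all add: w add_divide_le_add_one)
    ultimately show ?thesis using eq unfolding mean w_def[symmetric] by simp
  qed
  have "0 \<le> a" "a \<le> r 1 - 1" using assms(3-6) by (simp_all add: a_def)
  then obtain y where y: "1 \<le> y" "y \<le> r 1" "y = (sqrt (4 * r 1 + a\<^sup>2) - a) / 2"
    "r 1 / y = (sqrt (4 * r 1 + a\<^sup>2) + a) / 2"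
    by (rule ex_diff_divide_eq)
  \<comment> \<open>Prices 2 and 3 at their maxima contribute \<open>a\<close> to the sum of
    differences; \<open>y\<close> contributes \<open>- a\<close>. Restricting makes \<open>x\<close>
    \<open>undefined\<close> off the index set, as membership in \<open>S_f\<close> demands.\<close>
  define x where "x = restrict (M(1 := m 1 * y)) {1..3}"
  have x: "x 1 = m 1 * y" "x 2 = M 2" "x 3 = M 3" by (simp_all add: x_def)
  have nz: "m 1 \<noteq> 0" "M 2 \<noteq> 0" "M 3 \<noteq> 0" using pos[of 1] pos[of 2] pos[of 3] by auto
  have r: "M 1 / x 1 = r 1 / y" "M 2 / m 2 = r 2" "M 3 / m 3 = r 3"
    using nz assms(2) M[of 1] by (simp_all add: x)
  have val: "arith_mean 3 (\<lambda>i. M i / x i) =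
      1 / 6 * (sqrt (4 * r 1 + a\<^sup>2) + (r 2 + 1) + (r 3 + 1))"
    unfolding mean r(1) y(4) x(2,3) using nz by (simp add: a_def field_simps)
  have "x \<in> (\<Pi>\<^sub>E i\<in>{1..3}. {m i..M i})"
    using pos[of 1] pos[of 2] pos[of 3] M[of 1] y(1,2)
    by (auto simp: x_def I mult.commute)
  \<comment> \<open>Reaching the same closed form as \<open>val\<close> is the balance constraint
    for \<open>x\<close>.\<close>
  moreover have "arith_mean 3 (\<lambda>i. x i / m i) =
      1 / 6 * (sqrt (4 * r 1 + a\<^sup>2) + (r 2 + 1) + (r 3 + 1))"
    unfolding mean x r(2,3) using nz y(3) by (simp add: a_def field_simps)
  ultimately have "x \<in> S_f 3 m M" by (simp add: S_f_def val)
  then have "1 / 6 * (sqrt (4 * r 1 + a\<^sup>2) + (r 2 + 1) + (r 3 + 1)) \<in>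
      (\<lambda>x. arith_mean 3 (\<lambda>i. M i / x i)) ` S_f 3 m M"
    by (intro image_eqI[where x = x] val[symmetric])
  then show ?thesis
    unfolding z_f_def a_def[symmetric]
    by (rule cSup_eq_maximum) (erule imageE, simp only: upper)
qed

end
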